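(* Let $\mathcal{H}$ be a separable infinite-dimensional Hilbert space and let $\mathcal{F} \subseteq \mathcal{B}(\mathcal{H})$ be a forward operator monoid. If an aleph vector for $\mathcal{F}$ exists, then it is unique up to a multiplicative constant; that is, if $u$ and $\mu$ are both $\mathcal{F}$-aleph vectors, then $u = c\mu$ for some $c \in \mathbb{C}$.
   Context: $\mathcal{B}(\mathcal{H})$ is the set of bounded linear operators on the complex Hilbert space $\mathcal{H}$, and $I$ is the identity operator. A collection $\mathcal{F} \subseteq \mathcal{B}(\mathcal{H})$ containing $I$ is a forward operator monoid if there is a commutative, discrete (countable), strict monoid $(\Lambda, b, n_0)$ (with binary operation $b$ and identity element $n_0$; strict means that it does not possess inverses) such that $\mathcal{F} = \{T_j\}_{j \in \Lambda}$ and the map $j \mapsto T_j$ is a monoid isomorphism from $(\Lambda, b, n_0)$ onto $(\mathcal{F}, \circ, I)$, where $\circ$ is composition. In particular: $T_{n_0} = I$; $T_jT_k = T_{b(j,k)}$ for all $j,k\in\Lambda$; the elements of $\mathcal{F}$ commute; and the forward properties hold: $T_jT_k = I$ if and only if $j=k=n_0$, and $T_jT_k = T_k$ if and only if $j = n_0$. A non-zero vector $h \in \mathcal{H}$ is $\mathcal{F}$-cyclic if the closed linear span $[h]_{\mathcal{F}}$ of $\{Th : T \in \mathcal{F}\}$ equals $\mathcal{H}$; it is $\mathcal{F}$-inner if $\langle Th, h\rangle = 0$ for all $T \in \mathcal{F}\setminus\{I\}$; it is an $\mathcal{F}$-aleph (aleph vector for $\mathcal{F}$) if it is both $\mathcal{F}$-cyclic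 and $\mathcal{F}$-inner. *)

theory Defs
  imports "HOL-Analysis.Analysis" "HOL-Algebra.Group"
begin

section \<open>Complex Hilbert spaces\<close>

text \<open>
  A complex inner product space is presented as a \<^class>\<open>real_inner\<close> space with a compatible complex
  structure. Since the real inner product is the real part of the complex one, positive definiteness
  and the identity of the norm of \<open>x\<close> with the square root of \<open>\<langle>x, x\<rangle>\<close> are inherited
  from \<^class>\<open>real_inner\<close>. The complex inner product is linear in its first argument.
\<close>

class complex_inner = real_inner +
  fixes scaleC :: "complex \<Rightarrow> 'a \<Rightarrow> 'a" (infixr \<open>*\<^sub>C\<close> 75)
    and cinner :: "'a \<Rightarrow> 'a \<Rightarrow> complex"
  assumes scaleC_add_right: "c *\<^sub>C (x + y) = c *\<^sub>C x + c *\<^sub>C y"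
    and scaleC_add_left: "(c + d) *\<^sub>C x = c *\<^sub>C x + d *\<^sub>C x"
    and scaleC_scaleC: "c *\<^sub>C (d *\<^sub>C x) = (c * d) *\<^sub>C x"
    and scaleR_scaleC: "r *\<^sub>R x = complex_of_real r *\<^sub>C x"
    and cinner_commute: "cinner x y = cnj (cinner y x)"
    and cinner_add_left: "cinner (x + y) z = cinner x z + cinner y z"
    and cinner_scaleC_left: "cinner (c *\<^sub>C x) y = c * cinner x y"
    and inner_eq_Re_cinner: "inner x y = Re (cinner x y)"

class chilbert_space = complex_inner + complete_space

lemma scaleC_one: "1 *\<^sub>C x = (x :: 'a::complex_inner)"
  using scaleR_scaleC[of 1 x] by simp

global_interpretation complex_vector: vector_space "scaleC :: complex \<Rightarrow> 'a \<Rightarrow> 'a::complex_inner"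
  defines cspan = complex_vector.span
  by unfold_locales (simp_all add: scaleC_add_right scaleC_add_left scaleC_scaleC scaleC_one)

definition infinite_cdim :: "'a::complex_inner itself \<Rightarrow> bool" where
  "infinite_cdim _ \<longleftrightarrow> \<not> (\<exists>B :: 'a set. finite B \<and> cspan B = UNIV)"

definition bounded_clinear :: "('a::complex_inner \<Rightarrow> 'a) \<Rightarrow> bool" where
  "bounded_clinear T \<longleftrightarrow> bounded_linear T \<and> (\<forall>c x. T (c *\<^sub>C x) = c *\<^sub>C T x)"


section \<open>Forward operator monoids\<close>

definition strict_monoid :: "('i, 'm) monoid_scheme \<Rightarrow> bool" where
  "strict_monoid \<Lambda> \<longleftrightarrow> Units \<Lambda> = {\<one>\<^bsub>\<Lambda>\<^esub>}"

definition composition_monoid :: "('a \<Rightarrow> 'a) set \<Rightarrow> ('a \<Rightarrow> 'a) monoid" where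
  "composition_monoid F = \<lparr>carrier = F, mult = (\<circ>), one = id\<rparr>"

text \<open>
  A monoid isomorphism preserves the identity. This is stated separately because \<^const>\<open>iso\<close> only
  mentions the multiplication.
\<close>

definition forward_indexing ::
    "('i, 'm) monoid_scheme \<Rightarrow> ('i \<Rightarrow> 'a \<Rightarrow> 'a) \<Rightarrow> ('a \<Rightarrow> 'a) set \<Rightarrow> bool" where
  "forward_indexing \<Lambda> T F \<longleftrightarrow>
     comm_monoid \<Lambda> \<and> countable (carrier \<Lambda>) \<and> strict_monoid \<Lambda> \<and>
     T \<in> iso \<Lambda> (composition_monoid F) \<and> T \<one>\<^bsub>\<Lambda>\<^esub> = id"

text \<open>
  The index monoid is countable, so it is no restriction to let its elements be natural numbers (with
  an arbitrary operation); see \<open>forward_operator_monoidI\<close> below. The forward property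
  \<open>T\<^sub>j T\<^sub>k = I \<longleftrightarrow> j = k = n\<^sub>0\<close> follows from strictness. The companion property
  \<open>T\<^sub>j T\<^sub>k = T\<^sub>k \<longleftrightarrow> j = n\<^sub>0\<close> does not follow from the absence of inverses (idempotents violate
  it) and is not imposed, so the definition also covers every monoid that satisfies it.
\<close>

definition forward_operator_monoid :: "('a::complex_inner \<Rightarrow> 'a) set \<Rightarrow> bool" where
  "forward_operator_monoid F \<longleftrightarrow>
     (\<forall>T\<in>F. bounded_clinear T) \<and> id \<in> F \<and>
     (\<exists>(\<Lambda> :: nat monoid) T. forward_indexing \<Lambda> T F)"

lemma forward_operator_monoidI:
  fixes \<Lambda> :: "('i, 'm) monoid_scheme" and F :: "('a::complex_inner \<Rightarrow> 'a) set"
  assumes F: "\<forall>T\<in>F. bounded_clinear T" and T: "forward_indexing \<Lambda> T F"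
  shows "forward_operator_monoid F"
proof -
  interpret comm_monoid \<Lambda>
    using T by (simp add: forward_indexing_def)
  have cnt: "countable (carrier \<Lambda>)" and st: "Units \<Lambda> = {\<one>\<^bsub>\<Lambda>\<^esub>}" and T1: "T \<one>\<^bsub>\<Lambda>\<^esub> = id"
    and bij: "bij_betw T (carrier \<Lambda>) F"
    and hom: "\<And>x y. x \<in> carrier \<Lambda> \<Longrightarrow> y \<in> carrier \<Lambda> \<Longrightarrow> T (x \<otimes>\<^bsub>\<Lambda>\<^esub> y) = T x \<circ> T y"
    using T by (auto simp: forward_indexing_def strict_monoid_def iso_def hom_def composition_monoid_def)
  define e where "e = to_nat_on (carrier \<Lambda>)"
  define d where "d = from_nat_into (carrier \<Lambda>)"
  define M where "M = \<lparr>carrier = e ` carrier \<Lambda>, mult = (\<lambda>m n. e (d m \<otimes>\<^bsub>\<Lambda>\<^esub> d n)), one = e \<one>\<^bsub>\<Lambda>\<^esub>\<rparr>"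
  have de [simp]: "d (e x) = x" if "x \<in> carrier \<Lambda>" for x
    using that cnt by (simp add: d_def e_def)
  have ee: "e x = e y \<longleftrightarrow> x = y" if "x \<in> carrier \<Lambda>" "y \<in> carrier \<Lambda>" for x y
    using that de by metis
  have 1: "comm_monoid M"
    by (unfold_locales) (auto simp: M_def m_assoc intro: arg_cong[OF m_comm])
  have 2: "countable (carrier M)"
    by simp
  have 3: "strict_monoid M"
  proof -
    have "m = \<one>\<^bsub>M\<^esub>" if m: "m \<in> Units M" for m
    proof -
      obtain n where mn: "m \<in> carrier M" "n \<in> carrier M" "n \<otimes>\<^bsub>M\<^esub> m = \<one>\<^bsub>M\<^esub>"
        using m unfolding Units_def by blast
      obtain x y where x: "x \<in> carrier \<Lambda>" "m = e x" and y: "y \<in> carrier \<Lambda>" "n = e y"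
        using mn(1,2) unfolding M_def by auto
      then have "e (y \<otimes>\<^bsub>\<Lambda>\<^esub> x) = e \<one>\<^bsub>\<Lambda>\<^esub>"
        using mn(3) by (simp add: M_def)
      then have "y \<otimes>\<^bsub>\<Lambda>\<^esub> x = \<one>\<^bsub>\<Lambda>\<^esub>"
        using ee[of "y \<otimes>\<^bsub>\<Lambda>\<^esub> x" "\<one>\<^bsub>\<Lambda>\<^esub>"] by (simp add: x y)
      then have "x \<in> Units \<Lambda>"
        using x y m_comm[of y x] by (auto simp: Units_def)
      then show ?thesis
        using st x by (simp add: M_def)
    qed
    moreover have "\<one>\<^bsub>M\<^esub> \<in> Units M"
      using 1 by (simp add: comm_monoid_def monoid.Units_one_closed)
    ultimately show ?thesis
      unfolding strict_monoid_def by blast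
  qed
  have "bij_betw d (carrier M) (carrier \<Lambda>)"
    by (rule bij_betw_byWitness[where f' = e]) (auto simp: M_def)
  then have bTd: "bij_betw (T \<circ> d) (carrier M) F"
    using bij by (rule bij_betw_trans)
  moreover have "(T \<circ> d) (x \<otimes>\<^bsub>M\<^esub> y) = (T \<circ> d) x \<circ> (T \<circ> d) y"
    if "x \<in> carrier M" "y \<in> carrier M" for x y
    using that by (auto simp: M_def hom)
  moreover have "T \<circ> d \<in> carrier M \<rightarrow> F"
    using bTd by (rule bij_betw_imp_funcset)
  ultimately have 4: "T \<circ> d \<in> iso M (composition_monoid F)"
    unfolding iso_def hom_def composition_monoid_def by simp
  have 5: "(T \<circ> d) \<one>\<^bsub>M\<^esub> = id"
    by (simp add: M_def T1)
  have "forward_indexing M (T \<circ> d) F"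
    using 1 2 3 4 5 by (simp add: forward_indexing_def)
  moreover have "id \<in> F"
    using bij T1 one_closed by (metis bij_betwE)
  ultimately show ?thesis
    using F unfolding forward_operator_monoid_def by blast
qed


section \<open>Aleph vectors\<close>

definition cyclic_vector :: "('a::complex_inner \<Rightarrow> 'a) set \<Rightarrow> 'a \<Rightarrow> bool" where
  "cyclic_vector F h \<longleftrightarrow> h \<noteq> 0 \<and> closure (cspan {T h | T. T \<in> F}) = UNIV"

definition inner_vector :: "('a::complex_inner \<Rightarrow> 'a) set \<Rightarrow> 'a \<Rightarrow> bool" where
  "inner_vector F h \<longleftrightarrow> h \<noteq> 0 \<and> (\<forall>T \<in> F - {id}. cinner (T h) h = 0)"

definition aleph_vector :: "('a::complex_inner \<Rightarrow> 'a) set \<Rightarrow> 'a \<Rightarrow> bool" where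
  "aleph_vector F h \<longleftrightarrow> cyclic_vector F h \<and> inner_vector F h"

end

theory Submission
  imports Defs
begin

text \<open>
  Write \<open>M\<close> for the closed linear span of the ranges \<open>T(H)\<close>, \<open>T \<in> F - {I}\<close>. This space depends
  on \<open>F\<close> alone, and an aleph vector spans its orthogonal complement: that is why it is unique up
  to a scalar.

  Two facts make this precise. First, every aleph vector \<open>u\<close> is orthogonal to \<open>M\<close>
  (\<open>aleph_vector_orthogonal_range\<close>): the orbit of \<open>u\<close> is total in the space, \<open>T\<close> maps the orbit
  element \<open>S u\<close> to \<open>(T S) u\<close>, and \<open>T S \<noteq> I\<close> because the monoid is strict, so \<open>(T S) u\<close> is orthogonal
  to \<open>u\<close>. Second, if \<open>\<mu>\<close> is an aleph vector, then its orbit consists of \<open>\<mu>\<close> itself and of vectors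
  of \<open>M\<close>, and its orbit is total, so a vector orthogonal to \<open>M\<close> and to \<open>\<mu>\<close> vanishes. This applies
  to \<open>u - c \<mu>\<close>, where \<open>c \<mu>\<close> is the orthogonal projection of \<open>u\<close> on the line through \<open>\<mu>\<close>.
\<close>

lemma cinner_add_right: "cinner x (y + z) = cinner x y + cinner x z"
  by (metis cinner_add_left cinner_commute complex_cnj_add)

lemma cinner_scaleC_right: "cinner x (c *\<^sub>C y) = cnj c * cinner x y"
  by (metis cinner_commute cinner_scaleC_left complex_cnj_mult)

lemma cinner_zero_left: "cinner 0 x = 0"
  using cinner_add_left[of 0 0 x] by simp

lemma cinner_diff_right: "cinner x (y - z) = cinner x y - cinner x z"
  using cinner_add_right[of x "y - z" z] by simp

lemma cinner_self_eq_0_iff: "cinner x x = 0 \<longleftrightarrow> x = 0"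
  by (metis cinner_zero_left inner_eq_Re_cinner inner_eq_zero_iff zero_complex.sel(1))

text \<open>Multiplying \<open>y\<close> by \<open>\<i>\<close> turns the imaginary part of \<open>\<langle>x, y\<rangle>\<close> into a real part, so complex
  orthogonality consists of two real conditions, to which the topology of real inner product spaces
  applies.\<close>

lemma cinner_eq_0_iff_inner: "cinner x y = 0 \<longleftrightarrow> inner x y = 0 \<and> inner x (\<i> *\<^sub>C y) = 0"
  by (simp add: inner_eq_Re_cinner cinner_scaleC_right complex_eq_iff)

text \<open>In a commutative monoid the factors of a product equal to the identity are units, so strictness
  turns \<open>S T = I\<close> into \<open>S = I\<close>. The remaining content is the transport along the indexing
  isomorphism.\<close>

lemma forward_operator_monoid_comp_neq_id:
  assumes F: "forward_operator_monoid F" and S: "S \<in> F - {id}" and T: "T \<in> F"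
  shows "S \<circ> T \<in> F - {id}"
proof -
  obtain L :: "nat monoid" and X where X: "forward_indexing L X F"
    using F unfolding forward_operator_monoid_def by blast
  interpret comm_monoid L
    using X by (simp add: forward_indexing_def)
  have units: "Units L = {\<one>\<^bsub>L\<^esub>}" and X1: "X \<one>\<^bsub>L\<^esub> = id" and bij: "bij_betw X (carrier L) F"
    and hom: "\<And>j k. j \<in> carrier L \<Longrightarrow> k \<in> carrier L \<Longrightarrow> X (j \<otimes>\<^bsub>L\<^esub> k) = X j \<circ> X k"
    using X by (auto simp: forward_indexing_def strict_monoid_def iso_def hom_def composition_monoid_def)
  obtain j k where j: "j \<in> carrier L" "S = X j" and k: "k \<in> carrier L" "T = X k"
    using bij S T unfolding bij_betw_def by blast
  have "S \<circ> T = X (j \<otimes>\<^bsub>L\<^esub> k)"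
    using hom j k by simp
  then have "S \<circ> T \<in> F"
    using bij_betwE[OF bij] j k by simp
  moreover have "S \<circ> T \<noteq> id"
  proof
    assume "S \<circ> T = id"
    then have "X (j \<otimes>\<^bsub>L\<^esub> k) = X \<one>\<^bsub>L\<^esub>"
      using hom j k X1 by simp
    then have "j \<otimes>\<^bsub>L\<^esub> k = \<one>\<^bsub>L\<^esub>"
      using bij j k by (auto simp: bij_betw_def dest: inj_onD)
    then have "j \<in> Units L"
      using j k m_comm[of j k] by (auto simp: Units_def)
    then show False
      using units S j X1 by simp
  qed
  ultimately show ?thesis
    by simp
qed

text \<open>The vectors \<open>x\<close> with \<open>\<langle>A x, v\<rangle> = 0\<close> form a closed complex subspace. It is the whole space as
  soon as it contains the orbit of a cyclic vector.\<close>

lemma cyclic_vector_orthogonalI: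
  assumes h: "cyclic_vector F h" and A: "bounded_clinear A"
    and orth: "\<And>S. S \<in> F \<Longrightarrow> cinner (A (S h)) v = 0"
  shows "cinner (A x) v = 0"
proof -
  let ?K = "{x. cinner (A x) v = 0}"
  have lin: "bounded_linear A" and scale: "\<And>c x. A (c *\<^sub>C x) = c *\<^sub>C A x"
    using A by (auto simp: bounded_clinear_def)
  have "complex_vector.subspace ?K"
    by (auto simp: complex_vector.subspace_def linear_0 linear_add scale cinner_zero_left
        cinner_add_left cinner_scaleC_left bounded_linear.linear[OF lin])
  moreover have "{T h | T. T \<in> F} \<subseteq> ?K"
    using orth by auto
  ultimately have "cspan {T h | T. T \<in> F} \<subseteq> ?K"
    using complex_vector.span_minimal by blast
  moreover have "closed ?K"
    unfolding cinner_eq_0_iff_inner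
    by (intro closed_Collect_conj closed_Collect_eq continuous_intros
        linear_continuous_on lin)
  ultimately have "closure (cspan {T h | T. T \<in> F}) \<subseteq> ?K"
    by (rule closure_minimal)
  then show ?thesis
    using h by (auto simp: cyclic_vector_def)
qed

lemma aleph_vector_orthogonal_range:
  assumes F: "forward_operator_monoid F" and u: "aleph_vector F u" and T: "T \<in> F - {id}"
  shows "cinner (T x) u = 0"
proof (rule cyclic_vector_orthogonalI[where A = T and F = F and h = u])
  show "cyclic_vector F u"
    using u by (simp add: aleph_vector_def)
  show "bounded_clinear T"
    using F T by (simp add: forward_operator_monoid_def)
  show "cinner (T (S u)) u = 0" if "S \<in> F" for S
  proof -
    have "T \<circ> S \<in> F - {id}"
      using F T that by (rule forward_operator_monoid_comp_neq_id)
    then have "cinner ((T \<circ> S) u) u = 0"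
      using u unfolding aleph_vector_def inner_vector_def by blast
    then show ?thesis
      by simp
  qed
qed

theorem theorem3p3:
  fixes F :: "('a::chilbert_space \<Rightarrow> 'a) set" and u \<mu> :: 'a
  assumes "separable_space (euclidean :: 'a topology)"
    and "infinite_cdim TYPE('a)"
    and "forward_operator_monoid F"
    and "aleph_vector F u"
    and "aleph_vector F \<mu>"
  shows "\<exists>c. u = c *\<^sub>C \<mu>"
proof -
  have cyc: "cyclic_vector F \<mu>" and "\<mu> \<noteq> 0"
    using assms(5) by (auto simp: aleph_vector_def inner_vector_def)
  then have nz: "cinner \<mu> \<mu> \<noteq> 0"
    by (simp add: cinner_self_eq_0_iff)
  \<comment> \<open>The inner product is antilinear in its second argument, so the coefficient of the projection
    is conjugated.\<close>
  define c where "c = cnj (cinner \<mu> u / cinner \<mu> \<mu>)"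
  define v where "v = u - c *\<^sub>C \<mu>"
  have orth: "cinner (S \<mu>) v = 0" if S: "S \<in> F" for S
  proof (cases "S = id")
    case True
    then show ?thesis
      using nz by (simp add: v_def c_def cinner_diff_right cinner_scaleC_right)
  next
    case False
    then have "S \<in> F - {id}"
      using S by simp
    then have "cinner (S \<mu>) u = 0" "cinner (S \<mu>) \<mu> = 0"
      using aleph_vector_orthogonal_range assms(3,4,5) by blast+
    then show ?thesis
      by (simp add: v_def cinner_diff_right cinner_scaleC_right)
  qed
  have "bounded_clinear (id :: 'a \<Rightarrow> 'a)"
    using assms(3) by (simp add: forward_operator_monoid_def)
  then have "cinner (id v) v = 0"
    by (rule cyclic_vector_orthogonalI[OF cyc, where A = id]) (simp add: orth)
  then have "v = 0"
    by (simp add: cinner_self_eq_0_iff)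
  then show ?thesis
    by (auto simp: v_def)
qed

end
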